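(* Let $\mathcal{H}$ be a separable infinite-dimensional complex Hilbert space, and let $(U_t)_{t \in \mathbb{R}}$ be a uniformly continuous group of bounded operators on $\mathcal{H}$ whose (bounded) generator is denoted by $A$. The following assertions are equivalent: (i) for every uniformly continuous group $(T_t)_{t \in \mathbb{R}}$ on $\mathcal{H}$, there exist a closed subspace $\mathcal{M}$ of $\mathcal{H}$ invariant for $(U_t)_{t \in \mathbb{R}}$ (that is, for every $U_t$), a constant $\mu \ge 0$, and a bounded linear isomorphism $R : \mathcal{M} \to \mathcal{H}$ such that, for all $t \in \mathbb{R}$, $$T_t = R\, (U_{\mu t})_{|\mathcal{M}}\, R^{-1};$$ (ii) $A$ is universal.
   Context: A uniformly continuous group on $\mathcal{H}$ is a family $(T_t)_{t\in\mathbb{R}}$ of bounded operators with $T_0 = \mathrm{Id}$, $T_{t+s} = T_t T_s$ for all $s,t \in \mathbb{R}$, and $\lim_{t \to 0}\|T_t - \mathrm{Id}\| = 0$; equivalently $T_t = e^{tB}$ for a bounded operator $B$, which is its generator, $Bx = \lim_{t\to 0}(T_t x - x)/t$. An operator $A \in \mathcal{L}(\mathcal{H})$ (bounded linear operators on $\mathcal{H}$) is universal if, for every $T \in \mathcal{L}(\mathcal{H})$, there exist a closed subspace $\mathcal{M}$ of $\mathcal{H}$ invariant for $A$, a constant $\lambda \in \mathbb{C}$ and a bounded linear isomorphism $R : \mathcal{M} \to \mathcal{H}$ such that $T = \lambda R\, A_{|\mathcal{M}} R^{-1}$. *)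

theory Defs
  imports "HOL-Analysis.Analysis"
begin

text \<open>
  Complex inner product spaces, as real normed spaces with a compatible complex scalar
  multiplication and an inner product (linear in its first argument) that induces the norm.
\<close>

class complex_inner = real_normed_vector +
  fixes scaleC :: "complex \<Rightarrow> 'a \<Rightarrow> 'a"  (infixr "*\<^sub>C" 75)
    and cinner :: "'a \<Rightarrow> 'a \<Rightarrow> complex"
  assumes scaleC_add_right: "a *\<^sub>C (x + y) = a *\<^sub>C x + a *\<^sub>C y"
    and scaleC_add_left: "(a + b) *\<^sub>C x = a *\<^sub>C x + b *\<^sub>C x"
    and scaleC_scaleC: "a *\<^sub>C (b *\<^sub>C x) = (a * b) *\<^sub>C x"
    and scaleC_of_real: "complex_of_real r *\<^sub>C x = r *\<^sub>R x"
    and cinner_commute: "cinner x y = cnj (cinner y x)"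
    and cinner_add_left: "cinner (x + y) z = cinner x z + cinner y z"
    and cinner_scaleC_left: "cinner (a *\<^sub>C x) y = a * cinner x y"
    and cinner_ge_zero: "0 \<le> Re (cinner x x)"
    and cinner_eq_zero_iff: "cinner x x = 0 \<longleftrightarrow> x = 0"
    and norm_eq_sqrt_cinner: "norm x = sqrt (Re (cinner x x))"

class complex_hilbert_space = complex_inner + complete_space

global_interpretation complex_vector: vector_space "scaleC :: complex \<Rightarrow> 'a \<Rightarrow> 'a :: complex_inner"
  defines csubspace = complex_vector.subspace
    and cspan = complex_vector.span
proof
  fix x :: 'a
  show "1 *\<^sub>C x = x"
    using scaleC_of_real[of 1 x] by simp
qed (auto simp: scaleC_add_right scaleC_add_left scaleC_scaleC)

definition infinite_dimensional :: "'a::complex_inner itself \<Rightarrow> bool" where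
  "infinite_dimensional _ \<longleftrightarrow> \<not> (\<exists>S::'a set. finite S \<and> cspan S = UNIV)"

definition bounded_clinear :: "('a::complex_inner \<Rightarrow> 'a) \<Rightarrow> bool" where
  "bounded_clinear f \<longleftrightarrow> bounded_linear f \<and> (\<forall>c x. f (c *\<^sub>C x) = c *\<^sub>C f x)"

text \<open>Bounded linear isomorphisms from a subspace onto the whole space; only the values of
  \<open>R\<close> on \<open>M\<close> matter, and the inverse is \<open>inv_into M R\<close>.\<close>

definition bounded_clinear_iso_on :: "'a::complex_inner set \<Rightarrow> ('a \<Rightarrow> 'a) \<Rightarrow> bool" where
  "bounded_clinear_iso_on M R \<longleftrightarrow>
     bij_betw R M UNIV \<and>
     (\<forall>x\<in>M. \<forall>y\<in>M. R (x + y) = R x + R y) \<and>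
     (\<forall>c. \<forall>x\<in>M. R (c *\<^sub>C x) = c *\<^sub>C R x) \<and>
     (\<exists>K. \<forall>x\<in>M. norm (R x) \<le> K * norm x) \<and>
     (\<exists>K. \<forall>y. norm (inv_into M R y) \<le> K * norm y)"

definition uniformly_continuous_group :: "(real \<Rightarrow> 'a::complex_inner \<Rightarrow> 'a) \<Rightarrow> bool" where
  "uniformly_continuous_group T \<longleftrightarrow>
     (\<forall>t. bounded_clinear (T t)) \<and>
     T 0 = id \<and>
     (\<forall>t s. T (t + s) = T t \<circ> T s) \<and>
     ((\<lambda>t. onorm (\<lambda>x. T t x - x)) \<longlongrightarrow> 0) (at 0)"

definition is_generator :: "(real \<Rightarrow> 'a::complex_inner \<Rightarrow> 'a) \<Rightarrow> ('a \<Rightarrow> 'a) \<Rightarrow> bool" where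
  "is_generator T B \<longleftrightarrow> (\<forall>x. ((\<lambda>t. (T t x - x) /\<^sub>R t) \<longlongrightarrow> B x) (at 0))"

definition universal :: "('a::complex_inner \<Rightarrow> 'a) \<Rightarrow> bool" where
  "universal A \<longleftrightarrow>
     bounded_clinear A \<and>
     (\<forall>T. bounded_clinear T \<longrightarrow>
        (\<exists>M c R. csubspace M \<and> closed M \<and> A ` M \<subseteq> M \<and> bounded_clinear_iso_on M R \<and>
           (\<forall>x. T x = c *\<^sub>C R (A (inv_into M R x)))))"

end

theory Submission
  imports Defs
begin

text \<open>
  A uniformly continuous group is \<open>exp (t B)\<close> for a bounded \<open>B\<close>, its generator, so the theorem
  compares two kinds of similarity: of the groups, and of their generators. Both are expressed
  here by an embedding \<open>P\<close> of the whole space into itself (bounded and bounded below), which is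
  the inverse of the isomorphism \<open>R\<close>: its range is the invariant subspace, and \<open>T\<close> is, up to the
  similarity \<open>R\<close>, the multiple by \<open>c\<close> of the restriction of \<open>A\<close> to it iff \<open>P T = c A P\<close>.

  From groups to generators one differentiates \<open>P (exp (t B)) = exp (\<mu> t A) P\<close> at \<open>0\<close>, and
  conversely \<open>P B = \<mu> A P\<close> gives the identity of groups term by term in the exponential series.

  The real difficulty is that universality supplies a complex factor \<open>c\<close>, whereas a group only
  allows a real factor \<open>\<mu> \<ge> 0\<close>. The argument of \<open>c\<close> is absorbed by applying universality not to
  \<open>B\<close> but to an operator that contains all the rotated copies of \<open>B\<close> at once. Identify the space
  with the square-summable sequences of its own elements and let
  \<open>S (x\<^sub>0, x\<^sub>1, x\<^sub>2, \<dots>) = (B x\<^sub>1, B x\<^sub>2, \<dots>)\<close>, the backward shift tensored with \<open>B\<close>. For \<open>\<bar>z\<bar> < 1\<close>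
  the embedding \<open>J\<^sub>z x = (x, z x, z\<^sup>2 x, \<dots>)\<close> satisfies \<open>S J\<^sub>z = z J\<^sub>z B\<close>. If \<open>Q S = c A Q\<close> with
  \<open>c \<noteq> 0\<close>, the choice \<open>z = c / (2 \<bar>c\<bar>)\<close> yields \<open>P B = 2 \<bar>c\<bar> A P\<close> for \<open>P = Q J\<^sub>z\<close>, which is
  the lemma \<open>universal_positive_multiple\<close>. If \<open>c = 0\<close> then \<open>B = 0\<close> and its group is trivial.

  The identification with sequences rests on an orthonormal basis indexed by pairs of natural
  numbers. That a uniformly continuous group is an exponential is proved in an arbitrary unital
  Banach algebra (\<open>norm_continuous_group_is_exp\<close>), and then applied to bounded operators.
\<close>

section \<open>Complex inner product spaces\<close>

instance complex_hilbert_space \<subseteq> banach ..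

lemma cinner_add_right: "cinner x (y + z) = cinner x y + cinner x (z :: 'a::complex_inner)"
  by (metis cinner_add_left cinner_commute complex_cnj_add)

lemma cinner_scaleC_right: "cinner x (a *\<^sub>C y) = cnj a * cinner x (y :: 'a::complex_inner)"
  by (metis cinner_commute cinner_scaleC_left complex_cnj_mult)

lemma cinner_zero_left [simp]: "cinner 0 (x :: 'a::complex_inner) = 0"
  using cinner_add_left[of 0 0 x] by simp

lemma cinner_zero_right [simp]: "cinner x (0 :: 'a::complex_inner) = 0"
  using cinner_add_right[of x 0 0] by simp

lemma cinner_minus_left: "cinner (- x) (y :: 'a::complex_inner) = - cinner x y"
  using cinner_add_left[of x "- x" y] by (simp add: eq_neg_iff_add_eq_0 add.commute)

lemma cinner_diff_left: "cinner (x - y) (z :: 'a::complex_inner) = cinner x z - cinner y z"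
  using cinner_add_left[of x "- y" z] by (simp add: cinner_minus_left)

lemma cinner_diff_right: "cinner x (y - z :: 'a::complex_inner) = cinner x y - cinner x z"
  by (metis cinner_commute cinner_diff_left complex_cnj_diff)

lemma cinner_sum_left: "cinner (\<Sum>i\<in>F. f i) (y :: 'a::complex_inner) = (\<Sum>i\<in>F. cinner (f i) y)"
  by (induction F rule: infinite_finite_induct) (auto simp: cinner_add_left)

lemma cinner_sum_right: "cinner (y :: 'a::complex_inner) (\<Sum>i\<in>F. f i) = (\<Sum>i\<in>F. cinner y (f i))"
  by (induction F rule: infinite_finite_induct) (auto simp: cinner_add_right)

lemma cinner_self: "cinner x (x :: 'a::complex_inner) = of_real ((norm x)\<^sup>2)"
proof (rule complex_eqI)
  show "Re (cinner x x) = Re (of_real ((norm x)\<^sup>2))"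
    using norm_eq_sqrt_cinner[of x] cinner_ge_zero[of x] by simp
  show "Im (cinner x x) = Im (of_real ((norm x)\<^sup>2))"
    using arg_cong[OF cinner_commute[of x x], of Im] by simp
qed

lemma norm_scaleC: "norm (a *\<^sub>C x) = cmod a * norm (x :: 'a::complex_inner)"
proof -
  have "cinner (a *\<^sub>C x) (a *\<^sub>C x) = (a * cnj a) * cinner x x"
    by (simp add: cinner_scaleC_left cinner_scaleC_right)
  also have "\<dots> = of_real ((cmod a * norm x)\<^sup>2)"
    by (simp add: complex_norm_square[symmetric] cinner_self power_mult_distrib)
  finally have "cinner (a *\<^sub>C x) (a *\<^sub>C x) = of_real ((cmod a * norm x)\<^sup>2)" .
  then have "(norm (a *\<^sub>C x))\<^sup>2 = (cmod a * norm x)\<^sup>2"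
    by (metis cinner_self of_real_eq_iff)
  then show ?thesis by (simp add: power2_eq_iff_nonneg)
qed

lemma scaleR_eq_scaleC: "r *\<^sub>R x = complex_of_real r *\<^sub>C (x :: 'a::complex_inner)"
  by (simp add: scaleC_of_real)

lemma norm_diff_square:
  "(norm (x - y))\<^sup>2 = (norm x)\<^sup>2 - 2 * Re (cinner x y) + (norm (y :: 'a::complex_inner))\<^sup>2"
proof -
  have "complex_of_real ((norm (x - y))\<^sup>2) = cinner x x - (cinner x y + cnj (cinner x y)) + cinner y y"
    using cinner_commute[of y x] by (simp only: cinner_self[symmetric] cinner_diff_left cinner_diff_right) simp
  also have "\<dots> = of_real ((norm x)\<^sup>2 - 2 * Re (cinner x y) + (norm y)\<^sup>2)"
    by (simp add: cinner_self complex_add_cnj)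
  finally show ?thesis using of_real_eq_iff by blast
qed

text \<open>
  The Cauchy-Schwarz inequality: the squared distance from \<open>x\<close> to its projection on the line
  through \<open>y\<close> is nonnegative.
\<close>

lemma norm_cinner_le: "cmod (cinner x y) \<le> norm x * norm (y :: 'a::complex_inner)"
proof (cases "y = 0")
  case False
  define c where "c = cinner x y / of_real ((norm y)\<^sup>2)"
  have *: "cinner x (c *\<^sub>C y) = of_real ((cmod (cinner x y))\<^sup>2 / (norm y)\<^sup>2)"
    using complex_norm_square[of "cinner x y"]
    by (simp add: c_def cinner_scaleC_right mult.commute)
  have "cmod c = cmod (cinner x y) / (norm y)\<^sup>2"
    by (simp add: c_def norm_divide norm_power)
  then have "norm (c *\<^sub>C y) = cmod (cinner x y) / norm y"
    using False by (simp add: norm_scaleC power2_eq_square)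
  then have **: "(norm (c *\<^sub>C y))\<^sup>2 = (cmod (cinner x y))\<^sup>2 / (norm y)\<^sup>2"
    by (simp add: power_divide)
  have "0 \<le> (norm (x - c *\<^sub>C y))\<^sup>2" by simp
  also have "\<dots> = (norm x)\<^sup>2 - (cmod (cinner x y))\<^sup>2 / (norm y)\<^sup>2"
    unfolding norm_diff_square * ** by simp
  finally have "(cmod (cinner x y))\<^sup>2 \<le> (norm x * norm y)\<^sup>2"
    using False by (simp add: field_simps power_mult_distrib)
  then show ?thesis by (rule power2_le_imp_le) simp
qed simp

lemma bounded_linear_cinner_left: "bounded_linear (\<lambda>x. cinner x (y :: 'a::complex_inner))"
proof (rule bounded_linear_intro[where K = "norm y"])
  show "cinner (r *\<^sub>R x) y = r *\<^sub>R cinner x y" for r x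
    by (simp add: scaleR_eq_scaleC cinner_scaleC_left scaleR_conv_of_real)
qed (auto simp: cinner_add_left norm_cinner_le)

lemma bounded_linear_scaleC_right: "bounded_linear (\<lambda>x :: 'a::complex_inner. c *\<^sub>C x)"
proof (rule bounded_linear_intro[where K = "cmod c"])
  show "c *\<^sub>C r *\<^sub>R x = r *\<^sub>R c *\<^sub>C x" for r and x :: 'a
    by (simp add: scaleR_eq_scaleC scaleC_scaleC mult.commute)
qed (auto simp: scaleC_add_right norm_scaleC)

lemma scaleC_zero_left [simp]: "0 *\<^sub>C x = (0 :: 'a::complex_inner)"
  using scaleC_of_real[of 0 x] by simp

lemma scaleC_zero_right [simp]: "a *\<^sub>C (0 :: 'a::complex_inner) = 0"
  using scaleC_add_right[of a 0 0] by simp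

lemma bounded_clinearI:
  fixes f :: "'a::complex_inner \<Rightarrow> 'a"
  assumes "\<And>x y. f (x + y) = f x + f y" "\<And>c x. f (c *\<^sub>C x) = c *\<^sub>C f x"
    and "\<And>x. norm (f x) \<le> K * norm x"
  shows "bounded_clinear f"
  unfolding bounded_clinear_def
  using assms by (auto intro!: bounded_linear_intro[where K = K] simp: scaleR_eq_scaleC mult.commute)

lemma bounded_clinear_id: "bounded_clinear (\<lambda>x :: 'a::complex_inner. x)"
  by (rule bounded_clinearI[where K = 1]) auto

lemma
  assumes "bounded_clinear f"
  shows bounded_clinear_bounded_linear: "bounded_linear f"
    and bounded_clinear_scaleC: "f (c *\<^sub>C x) = c *\<^sub>C f x"
    and bounded_clinear_add: "f (x + y) = f x + f y"
    and bounded_clinear_zero: "f 0 = 0"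
  using assms by (auto simp: bounded_clinear_def linear_simps)

lemma bounded_clinear_compose:
  "bounded_clinear f \<Longrightarrow> bounded_clinear g \<Longrightarrow> bounded_clinear (\<lambda>x. f (g x))"
  by (simp add: bounded_clinear_def bounded_linear_compose)

section \<open>Orthogonal families\<close>

lemma norm_sum_orthogonal:
  fixes f :: "'i \<Rightarrow> 'a::complex_inner"
  assumes "finite F" and orth: "\<And>i j. i \<in> F \<Longrightarrow> j \<in> F \<Longrightarrow> i \<noteq> j \<Longrightarrow> cinner (f i) (f j) = 0"
  shows "(norm (\<Sum>i\<in>F. f i))\<^sup>2 = (\<Sum>i\<in>F. (norm (f i))\<^sup>2)"
proof -
  have "cinner (\<Sum>i\<in>F. f i) (\<Sum>i\<in>F. f i) = (\<Sum>i\<in>F. \<Sum>j\<in>F. cinner (f i) (f j))"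
    by (simp add: cinner_sum_left cinner_sum_right) (rule sum.swap)
  also have "\<dots> = (\<Sum>i\<in>F. \<Sum>j\<in>F. if i = j then cinner (f i) (f i) else 0)"
    by (intro sum.cong refl) (auto simp: orth)
  also have "\<dots> = of_real (\<Sum>i\<in>F. (norm (f i))\<^sup>2)"
    using assms(1) by (simp add: sum.delta cinner_self)
  finally show ?thesis
    by (metis cinner_self of_real_eq_iff)
qed

text \<open>
  The hypothesis on \<open>p\<close> says that \<open>p i\<close> is the projection of \<open>y\<close> to the line through \<open>p i\<close>. In this
  form Bessel's inequality covers projections to basis vectors as well as projections to
  orthogonal subspaces.
\<close>

lemma bessel:
  fixes p :: "'i \<Rightarrow> 'a::complex_inner"
  assumes "finite F" and orth: "\<And>i j. i \<in> F \<Longrightarrow> j \<in> F \<Longrightarrow> i \<noteq> j \<Longrightarrow> cinner (p i) (p j) = 0"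
    and proj: "\<And>i. i \<in> F \<Longrightarrow> cinner y (p i) = cinner (p i) (p i)"
  shows "(\<Sum>i\<in>F. (norm (p i))\<^sup>2) \<le> (norm y)\<^sup>2"
proof -
  let ?s = "\<Sum>i\<in>F. (norm (p i))\<^sup>2"
  have "cinner y (\<Sum>i\<in>F. p i) = of_real ?s"
    by (simp add: cinner_sum_right proj cinner_self)
  then have "(norm (y - (\<Sum>i\<in>F. p i)))\<^sup>2 = (norm y)\<^sup>2 - ?s"
    using norm_sum_orthogonal[of F p] assms(1) orth by (simp add: norm_diff_square del: of_real_sum)
  then show ?thesis
    using zero_le_power2[of "norm (y - (\<Sum>i\<in>F. p i))"] by linarith
qed

text \<open>
  By Pythagoras, the blocks of an orthogonal series are Cauchy as soon as those of the squared
  norms are; absolute convergence may fail.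
\<close>

lemma orthogonal_series:
  fixes f :: "nat \<Rightarrow> 'a::complex_hilbert_space"
  assumes orth: "\<And>i j. i \<noteq> j \<Longrightarrow> cinner (f i) (f j) = 0"
    and le: "\<And>N. (\<Sum>n<N. (norm (f n))\<^sup>2) \<le> K\<^sup>2" and "0 \<le> K"
  shows summable_orthogonal: "summable f" and norm_suminf_orthogonal: "norm (suminf f) \<le> K"
proof -
  have eq: "(norm (\<Sum>n\<in>F. f n))\<^sup>2 = (\<Sum>n\<in>F. (norm (f n))\<^sup>2)" if "finite F" for F
    by (rule norm_sum_orthogonal[OF that]) (rule orth)
  have "summable (\<lambda>n. (norm (f n))\<^sup>2)"
    by (rule summableI_nonneg_bounded[OF _ le]) simp
  then have C: "\<And>e. e > 0 \<Longrightarrow> \<exists>N. \<forall>m\<ge>N. \<forall>n. norm (\<Sum>n=m..<n. (norm (f n))\<^sup>2) < e"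
    by (auto simp: summable_Cauchy)
  show s: "summable f"
    unfolding summable_Cauchy
  proof (intro allI impI)
    fix e :: real assume "e > 0"
    then obtain N where N: "\<And>m n. m \<ge> N \<Longrightarrow> norm (\<Sum>n=m..<n. (norm (f n))\<^sup>2) < e\<^sup>2"
      using C[of "e\<^sup>2"] by auto
    show "\<exists>N. \<forall>m\<ge>N. \<forall>n. norm (sum f {m..<n}) < e"
    proof (intro exI allI impI)
      fix m n assume "N \<le> m"
      then have "(norm (sum f {m..<n}))\<^sup>2 < e\<^sup>2"
        using N[of m n] by (simp add: eq sum_nonneg)
      then show "norm (sum f {m..<n}) < e"
        using \<open>e > 0\<close> by (simp add: power2_less_imp_less)
    qed
  qed
  show "norm (suminf f) \<le> K"
  proof (rule Lim_norm_ubound[OF _ summable_LIMSEQ[OF s]])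
    have "norm (sum f {..<N}) \<le> K" for N
      using le[of N] \<open>0 \<le> K\<close> by (auto intro: power2_le_imp_le simp: eq)
    then show "\<forall>\<^sub>F N in sequentially. norm (sum f {..<N}) \<le> K" by simp
  qed simp
qed

section \<open>Orthonormal bases of a separable space\<close>

text \<open>
  Distinct orthonormal vectors are at distance \<open>\<surd>2\<close>, so points of a dense set that approximate
  them to within \<open>1/2\<close> are distinct.
\<close>

lemma countable_orthonormal_set:
  fixes E :: "'a::complex_inner set"
  assumes sep: "separable_space (euclidean :: 'a topology)"
    and E: "\<And>x y. x \<in> E \<Longrightarrow> y \<in> E \<Longrightarrow> cinner x y = (if x = y then 1 else 0)"
  shows "countable E"
proof -
  obtain D :: "'a set" where D: "countable D" "closure D = UNIV"
    using sep unfolding separable_space_def euclidean_closure_of topspace_euclidean by blast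
  have "\<exists>d\<in>D. dist d x < 1/2" for x
  proof -
    have "x \<in> closure D" using D(2) by simp
    then show ?thesis unfolding closure_approachable by (rule allE[of _ "1/2"]) simp
  qed
  then obtain d where d: "\<And>x. d x \<in> D" "\<And>x. dist (d x) x < 1/2" by metis
  have "inj_on d E"
  proof (rule inj_onI, rule ccontr)
    fix x y assume *: "x \<in> E" "y \<in> E" "d x = d y" "x \<noteq> y"
    have "dist x y < 1"
      using d(2)[of x] d(2)[of y] *(3) dist_triangle_half_r[of "d x" x 1 y]
      by (simp add: dist_commute)
    have "(norm x)\<^sup>2 = 1" "(norm y)\<^sup>2 = 1"
      using E[of x x] E[of y y] * by (auto simp: cinner_self simp del: of_real_power)
    then have "(norm (x - y))\<^sup>2 = 2"
      using E[of x y] * by (simp add: norm_diff_square)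
    moreover have "(norm (x - y))\<^sup>2 \<le> 1"
      using \<open>dist x y < 1\<close> by (simp add: dist_norm power_le_one)
    ultimately show False by simp
  qed
  then show ?thesis
    using D(1) d(1) by (intro countable_image_inj_on[of d E] countable_subset[of "d ` E" D]) auto
qed

locale orthonormal_basis =
  fixes e :: "nat \<Rightarrow> 'a::complex_hilbert_space"
  assumes orthonormal: "cinner (e i) (e j) = (if i = j then 1 else 0)"
    and total: "(\<And>n. cinner x (e n) = 0) \<Longrightarrow> x = 0"

text \<open>
  A maximal orthonormal set is total, since a nonzero vector orthogonal to it could be normalised
  and added. It is infinite: were it finite, the difference of any \<open>x\<close> and its finite expansion
  would be orthogonal to it, hence \<open>0\<close>, and the set would span the space.
\<close>

lemma orthonormal_basis_exists:
  assumes sep: "separable_space (euclidean :: 'a::complex_hilbert_space topology)"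
    and inf: "infinite_dimensional TYPE('a::complex_hilbert_space)"
  obtains e :: "nat \<Rightarrow> 'a::complex_hilbert_space" where "orthonormal_basis e"
proof -
  define \<A> where "\<A> = {E :: 'a set. \<forall>x\<in>E. \<forall>y\<in>E. cinner x y = (if x = y then 1 else 0)}"
  have "\<exists>E\<in>\<A>. \<forall>X\<in>\<A>. E \<subseteq> X \<longrightarrow> X = E"
  proof (rule subset_Zorn')
    fix \<C> assume "subset.chain \<A> \<C>"
    then have "\<C> \<subseteq> \<A>" "\<And>X Y. X \<in> \<C> \<Longrightarrow> Y \<in> \<C> \<Longrightarrow> X \<subseteq> Y \<or> Y \<subseteq> X"
      by (auto simp: subset_chain_def)
    then show "\<Union>\<C> \<in> \<A>"
      unfolding \<A>_def by (smt (verit) Union_iff mem_Collect_eq subsetD)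
  qed
  then obtain E where E: "\<And>x y. x \<in> E \<Longrightarrow> y \<in> E \<Longrightarrow> cinner x y = (if x = y then 1 else 0)"
    and max: "\<And>X. X \<in> \<A> \<Longrightarrow> E \<subseteq> X \<Longrightarrow> X = E"
    unfolding \<A>_def by auto
  have tot: "x = 0" if orth: "\<And>y. y \<in> E \<Longrightarrow> cinner x y = 0" for x
  proof (rule ccontr)
    assume "x \<noteq> 0"
    define u where "u = complex_of_real (1 / norm x) *\<^sub>C x"
    have uu: "cinner u u = 1"
      using \<open>x \<noteq> 0\<close> by (simp add: cinner_self u_def norm_scaleC norm_divide)
    have ux: "cinner u y = 0" "cinner y u = 0" if "y \<in> E" for y
      using orth[OF that] cinner_commute[of y u] by (auto simp: u_def cinner_scaleC_left)
    have "u \<notin> E"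
    proof
      assume "u \<in> E"
      from ux(1)[OF this] uu show False by simp
    qed
    moreover have "insert u E \<in> \<A>"
    proof -
      have "cinner v w = (if v = w then 1 else 0)" if "v \<in> insert u E" "w \<in> insert u E" for v w
        using that E[of v w] ux[of v] ux[of w] uu \<open>u \<notin> E\<close> by (cases "v = u"; cases "w = u") auto
      then show ?thesis unfolding \<A>_def by blast
    qed
    then have "u \<in> E" using max by blast
    ultimately show False by simp
  qed
  have "infinite E"
  proof
    assume fin: "finite E"
    have "x \<in> cspan E" for x
    proof -
      define p where "p = (\<Sum>y\<in>E. cinner x y *\<^sub>C y)"
      have "cinner p y = cinner x y" if "y \<in> E" for y
      proof -
        have "cinner p y = (\<Sum>z\<in>E. if z = y then cinner x y else 0)"
          unfolding p_def cinner_sum_left cinner_scaleC_left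
          by (rule sum.cong) (auto simp: E that)
        then show ?thesis using fin that by simp
      qed
      then have "x - p = 0"
        by (intro tot) (simp add: cinner_diff_left)
      moreover have "p \<in> cspan E"
        unfolding p_def
        by (intro complex_vector.span_sum complex_vector.span_scale complex_vector.span_base)
      ultimately show ?thesis by simp
    qed
    then show False using inf fin unfolding infinite_dimensional_def by blast
  qed
  moreover have "countable E" by (rule countable_orthonormal_set[OF sep E])
  ultimately have bij: "bij_betw (from_nat_into E) UNIV E"
    by (rule bij_betw_from_nat_into[rotated])
  have "orthonormal_basis (from_nat_into E)"
  proof
    show "cinner (from_nat_into E i) (from_nat_into E j) = (if i = j then 1 else 0)" for i j
    proof -
      have "from_nat_into E i \<in> E" "from_nat_into E j \<in> E"
        using bij by (auto simp: bij_betw_def)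
      from E[OF this] show ?thesis
        using bij by (simp add: bij_betw_def inj_eq)
    qed
    show "x = 0" if "\<And>n. cinner x (from_nat_into E n) = 0" for x
    proof (rule tot)
      fix y assume "y \<in> E"
      then obtain n where "y = from_nat_into E n"
        using bij unfolding bij_betw_def by (metis imageE)
      with that show "cinner x y = 0" by simp
    qed
  qed
  then show thesis by (rule that)
qed


section \<open>The space as a square sum of copies of itself\<close>

context orthonormal_basis
begin

lemma eq_if_same_coefficients: "(\<And>n. cinner x (e n) = cinner y (e n)) \<Longrightarrow> x = y"
  using total[of "x - y"] by (simp add: cinner_diff_left)

lemma norm_e [simp]: "norm (e i) = 1"
  by (simp add: norm_eq_sqrt_cinner orthonormal)

text \<open>
  The partial isometry that sends \<open>e (\<sigma> m)\<close> to \<open>e (\<tau> m)\<close> and the remaining basis vectors to \<open>0\<close>;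
  its adjoint exchanges \<open>\<sigma>\<close> and \<open>\<tau>\<close>.
\<close>

definition relabel :: "(nat \<Rightarrow> nat) \<Rightarrow> (nat \<Rightarrow> nat) \<Rightarrow> 'a \<Rightarrow> 'a" where
  "relabel \<sigma> \<tau> x = (\<Sum>m. cinner x (e (\<sigma> m)) *\<^sub>C e (\<tau> m))"

context
  fixes \<sigma> \<tau> :: "nat \<Rightarrow> nat"
  assumes inj: "inj \<sigma>" "inj \<tau>"
begin

lemma relabel_terms:
  shows relabel_orthogonal:
      "i \<noteq> j \<Longrightarrow> cinner (cinner x (e (\<sigma> i)) *\<^sub>C e (\<tau> i)) (cinner x (e (\<sigma> j)) *\<^sub>C e (\<tau> j)) = 0"
    and relabel_bound: "(\<Sum>m<N. (norm (cinner x (e (\<sigma> m)) *\<^sub>C e (\<tau> m)))\<^sup>2) \<le> (norm x)\<^sup>2"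
proof -
  show "cinner (cinner x (e (\<sigma> i)) *\<^sub>C e (\<tau> i)) (cinner x (e (\<sigma> j)) *\<^sub>C e (\<tau> j)) = 0" if "i \<noteq> j"
    using that inj by (simp add: cinner_scaleC_left cinner_scaleC_right orthonormal inj_eq)
  have "(\<Sum>m<N. (norm (cinner x (e (\<sigma> m)) *\<^sub>C e (\<sigma> m)))\<^sup>2) \<le> (norm x)\<^sup>2"
    by (rule bessel)
       (auto simp: cinner_scaleC_left cinner_scaleC_right orthonormal inj_eq[OF inj(1)])
  then show "(\<Sum>m<N. (norm (cinner x (e (\<sigma> m)) *\<^sub>C e (\<tau> m)))\<^sup>2) \<le> (norm x)\<^sup>2"
    by (simp add: norm_scaleC)
qed

lemma relabel_sums: "(\<lambda>m. cinner x (e (\<sigma> m)) *\<^sub>C e (\<tau> m)) sums relabel \<sigma> \<tau> x"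
  unfolding relabel_def
  by (intro summable_sums summable_orthogonal[OF relabel_orthogonal relabel_bound]) auto

lemma norm_relabel_le: "norm (relabel \<sigma> \<tau> x) \<le> norm x"
  unfolding relabel_def
  by (intro norm_suminf_orthogonal[OF relabel_orthogonal relabel_bound]) auto

lemma cinner_relabel_sums:
  "(\<lambda>m. cinner x (e (\<sigma> m)) * cinner (e (\<tau> m)) y) sums cinner (relabel \<sigma> \<tau> x) y"
  using bounded_linear.sums[OF bounded_linear_cinner_left relabel_sums, of x y]
  by (simp add: cinner_scaleC_left)

lemma cinner_relabel_image [simp]: "cinner (relabel \<sigma> \<tau> x) (e (\<tau> k)) = cinner x (e (\<sigma> k))"
proof -
  have "(\<lambda>m. cinner x (e (\<sigma> m)) * cinner (e (\<tau> m)) (e (\<tau> k))) =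
        (\<lambda>m. if m = k then cinner x (e (\<sigma> m)) else 0)"
    by (auto simp: orthonormal inj_eq[OF inj(2)])
  then show ?thesis
    using cinner_relabel_sums[of x "e (\<tau> k)"] sums_single[of k "\<lambda>m. cinner x (e (\<sigma> m))"]
    by (metis sums_unique2)
qed

lemma cinner_relabel_outside: "k \<notin> range \<tau> \<Longrightarrow> cinner (relabel \<sigma> \<tau> x) (e k) = 0"
proof -
  assume "k \<notin> range \<tau>"
  then have "cinner (e (\<tau> m)) (e k) = 0" for m
    by (auto simp: orthonormal)
  then show ?thesis
    using cinner_relabel_sums[of x "e k"] by (simp add: sums_iff)
qed

lemma bounded_clinear_relabel: "bounded_clinear (relabel \<sigma> \<tau>)"
proof (rule bounded_clinearI[where K = 1])
  note coeff = cinner_relabel_image cinner_relabel_outside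
  have "cinner (relabel \<sigma> \<tau> (x + y)) (e k) = cinner (relabel \<sigma> \<tau> x + relabel \<sigma> \<tau> y) (e k)" for x y k
    by (cases "k \<in> range \<tau>") (auto simp: coeff cinner_add_left)
  then show "relabel \<sigma> \<tau> (x + y) = relabel \<sigma> \<tau> x + relabel \<sigma> \<tau> y" for x y
    by (rule eq_if_same_coefficients)
  have "cinner (relabel \<sigma> \<tau> (c *\<^sub>C x)) (e k) = cinner (c *\<^sub>C relabel \<sigma> \<tau> x) (e k)" for c x k
    by (cases "k \<in> range \<tau>") (auto simp: coeff cinner_scaleC_left)
  then show "relabel \<sigma> \<tau> (c *\<^sub>C x) = c *\<^sub>C relabel \<sigma> \<tau> x" for c x
    by (rule eq_if_same_coefficients)
qed (use norm_relabel_le in auto)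

end

lemma cinner_relabel_adjoint:
  assumes "inj \<sigma>" "inj \<tau>"
  shows "cinner (relabel \<sigma> \<tau> x) y = cinner x (relabel \<tau> \<sigma> y)"
proof -
  have "(\<lambda>m. cnj (cinner y (e (\<tau> m)) * cinner (e (\<sigma> m)) x)) sums cnj (cinner (relabel \<tau> \<sigma> y) x)"
    by (simp only: sums_cnj cinner_relabel_sums assms)
  then have "(\<lambda>m. cinner x (e (\<sigma> m)) * cinner (e (\<tau> m)) y) sums cinner x (relabel \<tau> \<sigma> y)"
    by (simp add: cinner_commute[symmetric] mult.commute)
  then show ?thesis
    using sums_unique2[OF cinner_relabel_sums[OF assms]] by blast
qed

text \<open>
  With the basis arranged in a matrix by \<open>prod_encode\<close>, \<open>copy_in n\<close> is an isometry onto the closed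
  span of row \<open>n\<close>, and \<open>copy_out n\<close> is its adjoint, the \<open>n\<close>-th coordinate of a vector regarded as
  a sequence of vectors.
\<close>

definition copy_in :: "nat \<Rightarrow> 'a \<Rightarrow> 'a" where
  "copy_in n = relabel id (\<lambda>m. prod_encode (n, m))"

definition copy_out :: "nat \<Rightarrow> 'a \<Rightarrow> 'a" where
  "copy_out n = relabel (\<lambda>m. prod_encode (n, m)) id"

lemma inj_prod_encode_row: "inj (\<lambda>m. prod_encode (n, m))"
  by (auto simp: inj_def)

lemma bounded_clinear_copy_in: "bounded_clinear (copy_in n)"
  and bounded_clinear_copy_out: "bounded_clinear (copy_out n)"
  by (simp_all add: copy_in_def copy_out_def bounded_clinear_relabel inj_prod_encode_row)

lemma cinner_copy_in: "cinner (copy_in n x) y = cinner x (copy_out n y)"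
  unfolding copy_in_def copy_out_def
  by (intro cinner_relabel_adjoint inj_prod_encode_row inj_on_id)

lemma copy_out_copy_in: "copy_out k (copy_in n x) = (if k = n then x else 0)"
proof (rule eq_if_same_coefficients)
  fix m
  have "cinner (copy_out k (copy_in n x)) (e m) = cinner (copy_in n x) (e (prod_encode (k, m)))"
    using cinner_relabel_image[OF inj_prod_encode_row inj_on_id, where x = "copy_in n x" and k = m]
    by (simp add: copy_out_def)
  also have "\<dots> = (if k = n then cinner x (e m) else 0)"
  proof (cases "k = n")
    case True
    then show ?thesis
      using cinner_relabel_image[OF inj_on_id inj_prod_encode_row, where x = x and k = m]
      by (simp add: copy_in_def)
  next
    case False
    then have "prod_encode (k, m) \<notin> range (\<lambda>m. prod_encode (n, m))"
      by auto
    then show ?thesis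
      using False cinner_relabel_outside[OF inj_on_id inj_prod_encode_row]
      by (simp add: copy_in_def)
  qed
  finally show "cinner (copy_out k (copy_in n x)) (e m) = cinner (if k = n then x else 0) (e m)"
    by simp
qed

lemma cinner_copy_in_copy_in:
  "cinner (copy_in n x) (copy_in k y) = (if n = k then cinner x y else 0)"
  by (simp add: cinner_copy_in copy_out_copy_in)

lemma norm_copy_in [simp]: "norm (copy_in n x) = norm x"
  by (simp add: norm_eq_sqrt_cinner cinner_copy_in_copy_in)

lemma sum_norm_copy_out_le: "finite F \<Longrightarrow> (\<Sum>n\<in>F. (norm (copy_out n y))\<^sup>2) \<le> (norm y)\<^sup>2"
proof -
  assume "finite F"
  have adj: "cinner y (copy_in n x) = cinner (copy_out n y) x" for n x
    by (metis cinner_commute cinner_copy_in)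
  have "(\<Sum>n\<in>F. (norm (copy_in n (copy_out n y)))\<^sup>2) \<le> (norm y)\<^sup>2"
    by (rule bessel[OF \<open>finite F\<close>]) (auto simp: cinner_copy_in_copy_in adj)
  then show ?thesis by simp
qed

text \<open>
  The vector \<open>x\<close> goes to the sequence \<open>(x, z x, z\<^sup>2 x, \<dots>)\<close>, an eigenvector of the backward shift
  for the eigenvalue \<open>z\<close>.
\<close>

definition eigen_embedding :: "complex \<Rightarrow> 'a \<Rightarrow> 'a" where
  "eigen_embedding z x = (\<Sum>n. z ^ n *\<^sub>C copy_in n x)"

lemma eigen_embedding_sums:
  assumes "cmod z < 1"
  shows "(\<lambda>n. z ^ n *\<^sub>C copy_in n x) sums eigen_embedding z x"
  unfolding eigen_embedding_def
proof (rule summable_sums, rule summable_norm_cancel)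
  have "summable (\<lambda>n. cmod z ^ n)"
    using assms by (intro summable_geometric) simp
  then show "summable (\<lambda>n. norm (z ^ n *\<^sub>C copy_in n x))"
    by (simp add: norm_scaleC norm_power summable_mult2)
qed

lemma bounded_clinear_eigen_embedding:
  assumes "cmod z < 1"
  shows "bounded_clinear (eigen_embedding z)"
proof (rule bounded_clinearI)
  note s = eigen_embedding_sums[OF assms]
  show "eigen_embedding z (x + y) = eigen_embedding z x + eigen_embedding z y" for x y
    using sums_unique2[OF s[of "x + y"]] sums_add[OF s s, of x y]
    by (simp add: bounded_clinear_add[OF bounded_clinear_copy_in] scaleC_add_right)
  show "eigen_embedding z (c *\<^sub>C x) = c *\<^sub>C eigen_embedding z x" for c x
    using sums_unique2[OF s[of "c *\<^sub>C x"]] bounded_linear.sums[OF bounded_linear_scaleC_right s, of c x]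
    by (simp add: bounded_clinear_scaleC[OF bounded_clinear_copy_in] scaleC_scaleC mult.commute)
  have g: "summable (\<lambda>n. cmod z ^ n)"
    using assms by (intro summable_geometric) simp
  show "norm (eigen_embedding z x) \<le> (\<Sum>n. cmod z ^ n) * norm x" for x
  proof -
    have eq: "norm (z ^ n *\<^sub>C copy_in n x) = cmod z ^ n * norm x" for n
      by (simp add: norm_scaleC norm_power)
    have "norm (eigen_embedding z x) \<le> (\<Sum>n. norm (z ^ n *\<^sub>C copy_in n x))"
      unfolding eigen_embedding_def
      by (rule summable_norm) (unfold eq, rule summable_mult2[OF g])
    also have "\<dots> = (\<Sum>n. cmod z ^ n) * norm x"
      unfolding eq by (rule suminf_mult2[OF g, symmetric])
    finally show ?thesis .
  qed
qed

lemma copy_out_eigen_embedding: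
  assumes "cmod z < 1"
  shows "copy_out k (eigen_embedding z x) = z ^ k *\<^sub>C x"
proof -
  have "(\<lambda>n. copy_out k (z ^ n *\<^sub>C copy_in n x)) sums copy_out k (eigen_embedding z x)"
    by (rule bounded_linear.sums[OF bounded_clinear_bounded_linear[OF bounded_clinear_copy_out]
          eigen_embedding_sums[OF assms]])
  moreover have "copy_out k (z ^ n *\<^sub>C copy_in n x) = (if n = k then z ^ k *\<^sub>C x else 0)" for n
    by (auto simp: bounded_clinear_scaleC[OF bounded_clinear_copy_out] copy_out_copy_in)
  ultimately have "(\<lambda>n. if n = k then z ^ k *\<^sub>C x else 0) sums copy_out k (eigen_embedding z x)"
    by simp
  from sums_unique2[OF this sums_single] show ?thesis .
qed

text \<open>The sequence \<open>(x\<^sub>0, x\<^sub>1, x\<^sub>2, \<dots>)\<close> goes to \<open>(B x\<^sub>1, B x\<^sub>2, \<dots>)\<close>.\<close>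

definition backward_shift :: "('a \<Rightarrow> 'a) \<Rightarrow> 'a \<Rightarrow> 'a" where
  "backward_shift B y = (\<Sum>n. copy_in n (B (copy_out (Suc n) y)))"

context
  fixes B :: "'a \<Rightarrow> 'a"
  assumes B: "bounded_clinear B"
begin

lemma backward_shift_terms_orthogonal:
  "i \<noteq> j \<Longrightarrow> cinner (copy_in i (B (copy_out (Suc i) y))) (copy_in j (B (copy_out (Suc j) y))) = 0"
  by (simp add: cinner_copy_in_copy_in)

lemma backward_shift_terms_bound:
  "(\<Sum>n<N. (norm (copy_in n (B (copy_out (Suc n) y))))\<^sup>2) \<le> (onorm B * norm y)\<^sup>2"
proof -
  have bl: "bounded_linear B" using B by (rule bounded_clinear_bounded_linear)
  have "(\<Sum>n<N. (norm (copy_in n (B (copy_out (Suc n) y))))\<^sup>2)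
      \<le> (\<Sum>n<N. (onorm B)\<^sup>2 * (norm (copy_out (Suc n) y))\<^sup>2)"
    by (intro sum_mono) (use onorm[OF bl] in \<open>simp add: power_mono flip: power_mult_distrib\<close>)
  also have "\<dots> = (onorm B)\<^sup>2 * (\<Sum>n\<in>Suc ` {..<N}. (norm (copy_out n y))\<^sup>2)"
    by (simp add: sum_distrib_left sum.reindex)
  also have "\<dots> \<le> (onorm B)\<^sup>2 * (norm y)\<^sup>2"
    by (intro mult_left_mono sum_norm_copy_out_le) auto
  finally show ?thesis by (simp add: power_mult_distrib)
qed

lemma backward_shift_bound_nonneg: "0 \<le> onorm B * norm y"
  by (intro mult_nonneg_nonneg norm_ge_zero onorm_pos_le bounded_clinear_bounded_linear B)

lemma backward_shift_sums:
  "(\<lambda>n. copy_in n (B (copy_out (Suc n) y))) sums backward_shift B y"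
  unfolding backward_shift_def
  by (intro summable_sums
      summable_orthogonal[OF backward_shift_terms_orthogonal backward_shift_terms_bound
        backward_shift_bound_nonneg])

lemma bounded_clinear_backward_shift: "bounded_clinear (backward_shift B)"
proof (rule bounded_clinearI)
  note s = backward_shift_sums
  note lin = B bounded_clinear_copy_in bounded_clinear_copy_out
  show "backward_shift B (x + y) = backward_shift B x + backward_shift B y" for x y
    using sums_unique2[OF s[of "x + y"]] sums_add[OF s s, of x y]
    by (simp add: lin[THEN bounded_clinear_add])
  show "backward_shift B (c *\<^sub>C x) = c *\<^sub>C backward_shift B x" for c x
    using sums_unique2[OF s[of "c *\<^sub>C x"]] bounded_linear.sums[OF bounded_linear_scaleC_right s, of c x]
    by (simp add: lin[THEN bounded_clinear_scaleC])
  show "norm (backward_shift B y) \<le> onorm B * norm y" for y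
    unfolding backward_shift_def
    by (rule norm_suminf_orthogonal[OF backward_shift_terms_orthogonal backward_shift_terms_bound
          backward_shift_bound_nonneg])
qed

text \<open>
  The restriction of the single operator \<open>backward_shift B\<close> to the range of \<open>eigen_embedding z\<close> is
  similar to \<open>z B\<close>, for every \<open>z\<close> in the open unit disc: all arguments of \<open>z\<close> occur.
\<close>

lemma backward_shift_eigen_embedding:
  assumes "cmod z < 1"
  shows "backward_shift B (eigen_embedding z x) = z *\<^sub>C eigen_embedding z (B x)"
proof -
  note lin = B bounded_clinear_copy_in
  have "(\<lambda>n. z *\<^sub>C z ^ n *\<^sub>C copy_in n (B x)) sums (z *\<^sub>C eigen_embedding z (B x))"
    by (rule bounded_linear.sums[OF bounded_linear_scaleC_right eigen_embedding_sums[OF assms]])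
  moreover have "(\<lambda>n. z *\<^sub>C z ^ n *\<^sub>C copy_in n (B x)) sums backward_shift B (eigen_embedding z x)"
    using backward_shift_sums[of "eigen_embedding z x"]
    by (simp add: copy_out_eigen_embedding[OF assms] lin[THEN bounded_clinear_scaleC] scaleC_scaleC)
  ultimately show ?thesis by (rule sums_unique2[symmetric])
qed

end

end

section \<open>Norm-continuous one-parameter groups in Banach algebras\<close>

lemma neumann_series_inverse:
  fixes x :: "'b::{real_normed_algebra_1,banach}"
  assumes "norm x < 1"
  shows "(1 - x) * (\<Sum>n. x ^ n) = 1"
proof -
  have s: "summable (\<lambda>n. x ^ n)"
    using complete_algebra_summable_geometric[OF assms] .
  have "(\<Sum>n. x ^ n) = 1 + x * (\<Sum>n. x ^ n)"
    using suminf_split_head[OF s] suminf_mult[OF s, of x] by (simp add: algebra_simps)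
  then show ?thesis by (simp add: algebra_simps)
qed

text \<open>
  Continuity forces differentiability by an averaging argument: for small \<open>d\<close> the integral \<open>V\<close> of
  \<open>G\<close> over \<open>[0, d]\<close> is close to \<open>d\<close>, hence invertible, and \<open>G t * V\<close> is the integral of \<open>G\<close> over
  \<open>[t, t + d]\<close>, which is differentiable in \<open>t\<close>. With \<open>b\<close> the derivative of \<open>G\<close> at \<open>0\<close>, the product
  \<open>G t * exp (- t b)\<close> has derivative \<open>0\<close>.
\<close>

lemma norm_continuous_group_is_exp:
  fixes G :: "real \<Rightarrow> 'b::{real_normed_algebra_1,banach}"
  assumes G0: "G 0 = 1" and add: "\<And>s t. G (s + t) = G s * G t" and lim: "(G \<longlongrightarrow> 1) (at 0)"
  obtains b where "\<And>t. G t = exp (t *\<^sub>R b)"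
proof -
  have "isCont G t" for t
  proof -
    have "((\<lambda>h. G t * G h) \<longlongrightarrow> G t * 1) (at 0)"
      by (intro tendsto_intros lim)
    then show ?thesis
      by (simp add: isCont_iff add)
  qed
  then have cont: "continuous_on S G" for S
    by (simp add: continuous_at_imp_continuous_on)
  obtain d where d: "d > 0" "\<And>s. \<bar>s\<bar> \<le> d \<Longrightarrow> norm (G s - 1) \<le> 1/2"
  proof -
    obtain e where e: "e > 0" "\<And>s. s \<noteq> 0 \<Longrightarrow> \<bar>s\<bar> < e \<Longrightarrow> dist (G s) 1 < 1/2"
      using tendstoD[OF lim, of "1/2"] by (auto simp: eventually_at)
    show thesis
    proof (rule that[of "e/2"])
      fix s :: real assume "\<bar>s\<bar> \<le> e/2"
      then show "norm (G s - 1) \<le> 1/2"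
        using e(1) e(2)[of s] G0 by (cases "s = 0") (auto simp: dist_norm)
    qed (use e in auto)
  qed
  define V where "V = integral {0..d} G"
  have "norm (integral {0..d} (\<lambda>s. G s - 1)) \<le> 1/2 * (d - 0)"
    by (rule integral_bound) (use d in \<open>auto intro!: continuous_intros cont\<close>)
  also have "integral {0..d} (\<lambda>s. G s - 1) = V - d *\<^sub>R 1"
    unfolding V_def using d(1)
    by (subst Henstock_Kurzweil_Integration.integral_diff)
       (auto intro!: integrable_continuous_real cont continuous_intros)
  finally have V: "norm (V - d *\<^sub>R 1) \<le> d/2" by simp
  define x where "x = 1 - V /\<^sub>R d"
  have "x = - (V - d *\<^sub>R 1) /\<^sub>R d"
    using d(1) by (simp add: x_def algebra_simps)
  then have "norm x \<le> 1/2"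
    using V d(1) by (simp add: norm_minus_commute divide_simps)
  then have "(V /\<^sub>R d) * (\<Sum>n. x ^ n) = 1"
    using neumann_series_inverse[of x] by (simp add: x_def)
  then obtain W where W: "V * W = 1"
    by (metis mult_scaleR_left mult_scaleR_right)
  \<comment> \<open>The lower limit \<open>-1\<close> leaves room on both sides of \<open>0\<close>, where the derivative is taken.\<close>
  define F where "F u = integral {-1..u} G" for u
  have F: "(F has_vector_derivative G u) (at u)" if "u \<in> {-1<..<d+1}" for u
  proof -
    have "(F has_vector_derivative G u) (at u within {-1..d+1})"
      unfolding F_def by (rule integral_has_vector_derivative) (use that cont in auto)
    then show ?thesis
      using that by (subst (asm) at_within_interior) (auto simp: interior_atLeastAtMost_real)
  qed
  have GV: "G t * V = F (t + d) - F t" if "t \<in> {-1<..<1}" for t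
  proof -
    have "G t * V = integral {0..d} (\<lambda>s. G t * G s)"
      using integral_linear[OF integrable_continuous_real[OF cont] bounded_linear_mult_right, of 0 d "G t"]
      by (simp add: V_def o_def)
    also have "\<dots> = integral {0..d} (G \<circ> (+) t)"
      by (simp add: add[symmetric] o_def)
    also have "\<dots> = integral {0+t..d+t} G"
      by (rule integral_shift_Icc_real)
    also have "\<dots> = F (t + d) - F t"
      using Henstock_Kurzweil_Integration.integral_combine[of "-1" t "t+d" G] that d(1) integrable_continuous_real[OF cont, of "-1" "t+d"]
      by (simp add: F_def add.commute algebra_simps)
    finally show ?thesis .
  qed
  have shift: "((\<lambda>t. t + c) has_vector_derivative 1) (at s)" for c s :: real
    unfolding has_real_derivative_iff_has_vector_derivative[symmetric]
    by (auto intro!: derivative_eq_intros)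
  define b where "b = (G d - G 0) * W"
  have "((\<lambda>t. F (t + d)) has_vector_derivative G d) (at 0)"
    using vector_diff_chain_at[OF shift[of d 0], of F "G d"] F[of d] d(1)
    by (simp add: o_def)
  then have "((\<lambda>t. F (t + d) - F t) has_vector_derivative G d - G 0) (at 0)"
    by (intro has_vector_derivative_diff F) (use d in auto)
  then have "((\<lambda>t. (F (t + d) - F t) * W) has_vector_derivative b) (at 0)"
    unfolding b_def by (rule bounded_linear.has_vector_derivative[OF bounded_linear_mult_left])
  moreover have "(F (t + d) - F t) * W = G t" if "t \<in> {-1<..<1}" for t
    using GV[OF that] W by (metis mult.assoc mult_1_right)
  ultimately have D0: "(G has_vector_derivative b) (at 0)"
    using has_vector_derivative_transform_within_open[of _ b 0 "{-1<..<1}" G] by auto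
  have D: "(G has_vector_derivative G t * b) (at t)" for t
  proof -
    have "((\<lambda>s. G (s - t)) has_vector_derivative b) (at t)"
      using vector_diff_chain_at[OF shift[of "- t" t], of G b] D0
      by (simp add: o_def)
    then have "((\<lambda>s. G t * G (s - t)) has_vector_derivative G t * b) (at t)"
      by (rule bounded_linear.has_vector_derivative[OF bounded_linear_mult_right])
    then show ?thesis
      by (simp add: add[symmetric])
  qed
  have E: "((\<lambda>t. exp (t *\<^sub>R (- b))) has_vector_derivative (- b) * exp (t *\<^sub>R (- b))) (at t)" for t
    by (rule exp_scaleR_has_vector_derivative_left)
  have "((\<lambda>t. G t * exp (t *\<^sub>R (- b))) has_vector_derivative 0) (at t)" for t
    using has_vector_derivative_mult[OF D E, of t] by (simp add: mult.assoc)
  then have "((\<lambda>t. G t * exp (t *\<^sub>R (- b))) has_derivative (\<lambda>h. 0)) (at t within UNIV)" for t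
    by (simp add: has_vector_derivative_def)
  then obtain k where k: "G t * exp (t *\<^sub>R (- b)) = k" for t
    using has_derivative_zero_constant[of UNIV "\<lambda>t. G t * exp (t *\<^sub>R (- b))"] by auto
  have "k = 1" using k[of 0] G0 by simp
  have "G t = exp (t *\<^sub>R b)" for t
  proof -
    have "G t = G t * (exp (t *\<^sub>R (- b)) * exp (t *\<^sub>R b))"
      using exp_minus_inverse[of "- (t *\<^sub>R b)"] by simp
    also have "\<dots> = exp (t *\<^sub>R b)"
      using k[of t] \<open>k = 1\<close> by (simp add: mult.assoc[symmetric])
    finally show ?thesis .
  qed
  then show thesis by (rule that)
qed

section \<open>The Banach algebra of bounded operators\<close>

text \<open>
  A unital normed algebra needs a unit of norm \<open>1\<close>, but the identity of a trivial space has norm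
  \<open>0\<close>. The direct product with the real numbers, under the maximum norm, has a unit of norm \<open>1\<close>
  over every space; only the second component is of interest.
\<close>

context notes [[typedef_overloaded]]
begin
datatype 'a::real_normed_vector operator = Op (scalar: real) (blin: "'a \<Rightarrow>\<^sub>L 'a")
end

instantiation operator :: (real_normed_vector) real_normed_algebra_1
begin

definition zero_operator :: "'a operator" where
  "zero_operator = Op 0 0"
definition one_operator :: "'a operator" where
  "one_operator = Op 1 id_blinfun"
definition plus_operator :: "'a operator \<Rightarrow> 'a operator \<Rightarrow> 'a operator" where
  "plus_operator F G = Op (scalar F + scalar G) (blin F + blin G)"
definition minus_operator :: "'a operator \<Rightarrow> 'a operator \<Rightarrow> 'a operator" where
  "minus_operator F G = Op (scalar F - scalar G) (blin F - blin G)"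
definition uminus_operator :: "'a operator \<Rightarrow> 'a operator" where
  "uminus_operator F = Op (- scalar F) (- blin F)"
definition scaleR_operator :: "real \<Rightarrow> 'a operator \<Rightarrow> 'a operator" where
  "scaleR_operator r F = Op (r * scalar F) (r *\<^sub>R blin F)"
definition times_operator :: "'a operator \<Rightarrow> 'a operator \<Rightarrow> 'a operator" where
  "times_operator F G = Op (scalar F * scalar G) (blin F o\<^sub>L blin G)"
definition norm_operator :: "'a operator \<Rightarrow> real" where
  "norm_operator F = max \<bar>scalar F\<bar> (norm (blin F))"
definition sgn_operator :: "'a operator \<Rightarrow> 'a operator" where
  "sgn_operator F = scaleR (inverse (norm F)) F"
definition dist_operator :: "'a operator \<Rightarrow> 'a operator \<Rightarrow> real" where
  "dist_operator F G = norm (F - G)"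
definition [code del]:
  "(uniformity :: ('a operator \<times> 'a operator) filter) = (INF e\<in>{0<..}. principal {(x, y). dist x y < e})"
definition [code del]:
  "open (S :: 'a operator set) = (\<forall>x\<in>S. \<forall>\<^sub>F (x', y) in uniformity. x' = x \<longrightarrow> y \<in> S)"

instance
proof
  fix F G H :: "'a operator" and r s :: real
  note ops = zero_operator_def one_operator_def plus_operator_def minus_operator_def
    uminus_operator_def scaleR_operator_def times_operator_def norm_operator_def
    operator.expand
  show "F + G + H = F + (G + H)" by (simp add: ops)
  show "F + G = G + F" by (simp add: ops)
  show "0 + F = F" by (simp add: ops)
  show "- F + F = 0" by (simp add: ops)
  show "F - G = F + - G" by (simp add: ops)
  show "r *\<^sub>R (F + G) = r *\<^sub>R F + r *\<^sub>R G" by (simp add: ops algebra_simps)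
  show "(r + s) *\<^sub>R F = r *\<^sub>R F + s *\<^sub>R F" by (simp add: ops algebra_simps)
  show "r *\<^sub>R s *\<^sub>R F = (r * s) *\<^sub>R F" by (simp add: ops)
  show "1 *\<^sub>R F = F" by (simp add: ops)
  show "F * G * H = F * (G * H)" by (simp add: ops blinfun_eqI)
  have "id_blinfun o\<^sub>L blin F = blin F" "blin F o\<^sub>L id_blinfun = blin F"
    by (simp_all add: blinfun_eqI)
  then show "1 * F = F" "F * 1 = F" by (simp_all add: ops)
  show "(F + G) * H = F * H + G * H"
    by (simp add: ops algebra_simps bounded_bilinear.add_left[OF bounded_bilinear_blinfun_compose])
  show "F * (G + H) = F * G + F * H"
    by (simp add: ops algebra_simps bounded_bilinear.add_right[OF bounded_bilinear_blinfun_compose])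
  show "r *\<^sub>R F * G = r *\<^sub>R (F * G)" by (simp add: ops bounded_bilinear.scaleR_left[OF bounded_bilinear_blinfun_compose])
  show "F * r *\<^sub>R G = r *\<^sub>R (F * G)" by (simp add: ops bounded_bilinear.scaleR_right[OF bounded_bilinear_blinfun_compose])
  show "(0 :: 'a operator) \<noteq> 1" by (simp add: ops)
  show "sgn F = scaleR (inverse (norm F)) F" by (rule sgn_operator_def)
  show "dist F G = norm (F - G)" by (rule dist_operator_def)
  show "(uniformity :: ('a operator \<times> 'a operator) filter) = (INF e\<in>{0<..}. principal {(x, y). dist x y < e})"
    by (rule uniformity_operator_def)
  show "open S = (\<forall>x\<in>S. \<forall>\<^sub>F (x', y) in uniformity. x' = x \<longrightarrow> y \<in> S)" for S :: "'a operator set"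
    by (rule open_operator_def)
  show "norm F = 0 \<longleftrightarrow> F = 0"
    by (cases F) (auto simp: ops max_def split: if_splits)
  show "norm (F + G) \<le> norm F + norm G"
    using norm_triangle_ineq[of "blin F" "blin G"] by (auto simp: ops)
  show "norm (r *\<^sub>R F) = \<bar>r\<bar> * norm F"
    by (simp add: ops abs_mult max_mult_distrib_left)
  show "norm (F * G) \<le> norm F * norm G"
    using norm_blinfun_compose[of "blin F" "blin G"]
    by (auto simp: ops abs_mult intro!: mult_mono elim!: order_trans)
  show "norm (1 :: 'a operator) = 1"
    using norm_blinfun_id_le[where 'a='a] by (simp add: ops)
qed

end

instance operator :: (banach) banach
proof
  fix X :: "nat \<Rightarrow> 'a operator"
  assume X: "Cauchy X"
  have d: "dist (scalar F) (scalar G) \<le> dist F G" "dist (blin F) (blin G) \<le> dist F G" for F G :: "'a operator"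
    by (auto simp: dist_norm norm_operator_def minus_operator_def)
  have "Cauchy (\<lambda>n. scalar (X n))" "Cauchy (\<lambda>n. blin (X n))"
    using X unfolding Cauchy_def by (meson d order_le_less_trans)+
  then obtain r B where lim: "(\<lambda>n. scalar (X n)) \<longlonglongrightarrow> r" "(\<lambda>n. blin (X n)) \<longlonglongrightarrow> B"
    by (auto simp: Cauchy_convergent_iff convergent_def)
  have "(\<lambda>n. max \<bar>scalar (X n) - r\<bar> (norm (blin (X n) - B))) \<longlonglongrightarrow> max \<bar>r - r\<bar> (norm (B - B))"
    by (intro tendsto_intros lim)
  then have "(\<lambda>n. norm (X n - Op r B)) \<longlonglongrightarrow> 0"
    by (simp add: norm_operator_def minus_operator_def)
  then have "X \<longlonglongrightarrow> Op r B"
    by (simp add: LIM_zero_iff tendsto_norm_zero_iff)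
  then show "convergent X" by (auto simp: convergent_def)
qed

section \<open>Uniformly continuous groups and their generators\<close>

definition exponential :: "('a::banach \<Rightarrow> 'a) \<Rightarrow> real \<Rightarrow> 'a \<Rightarrow> 'a" where
  "exponential B t x = (\<Sum>n. (t ^ n / fact n) *\<^sub>R (B ^^ n) x)"

lemma bounded_linear_blin: "bounded_linear blin"
  by (rule bounded_linear_intro[where K = 1])
     (auto simp: plus_operator_def scaleR_operator_def norm_operator_def)

lemma bounded_linear_blin_apply: "bounded_linear (\<lambda>F. blin F x)"
  by (intro bounded_linear_compose[OF blinfun.bounded_linear_left bounded_linear_blin])

lemma blin_one [simp]: "blin 1 = id_blinfun"
  by (simp add: one_operator_def)

lemma blin_mult [simp]: "blin (F * G) = blin F o\<^sub>L blin G"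
  by (simp add: times_operator_def)

lemma blin_scaleR [simp]: "blin (r *\<^sub>R F) = r *\<^sub>R blin F"
  by (simp add: scaleR_operator_def)

lemma blin_power: "blin (F ^ n) x = (blinfun_apply (blin F) ^^ n) x"
  by (induction n) auto

lemma exponential_sums_blin_exp:
  fixes F :: "'a::banach operator"
  shows "(\<lambda>n. (t ^ n / fact n) *\<^sub>R (blinfun_apply (blin F) ^^ n) x) sums blin (exp (t *\<^sub>R F)) x"
proof -
  have "(\<lambda>n. blin ((t *\<^sub>R F) ^ n /\<^sub>R fact n) x) sums blin (exp (t *\<^sub>R F)) x"
    by (rule bounded_linear.sums[OF bounded_linear_blin_apply exp_converges])
  moreover have "blin ((t *\<^sub>R F) ^ n /\<^sub>R fact n) x = (t ^ n / fact n) *\<^sub>R (blinfun_apply (blin F) ^^ n) x" for n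
    by (simp add: scaleR_power blinfun.scaleR_left blin_power field_simps)
  ultimately show ?thesis by simp
qed

lemma exponential_eq_blin_exp: "exponential (blin F) t x = blin (exp (t *\<^sub>R F)) x"
  unfolding exponential_def by (rule sums_unique[OF exponential_sums_blin_exp, symmetric])

lemma blin_Op_Blinfun: "bounded_linear B \<Longrightarrow> blinfun_apply (blin (Op r (Blinfun B))) = B"
  by (simp add: bounded_linear_Blinfun_apply)

lemma exponential_sums:
  assumes "bounded_linear B"
  shows "(\<lambda>n. (t ^ n / fact n) *\<^sub>R (B ^^ n) x) sums exponential B t x"
  using exponential_sums_blin_exp[of t "Op 0 (Blinfun B)" x]
    exponential_eq_blin_exp[of "Op 0 (Blinfun B)" t x] assms
  by (simp add: bounded_linear_Blinfun_apply)

lemma exponential_rescale: "exponential (\<lambda>x. r *\<^sub>R A x) t x = exponential A (r * t) x"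
  if A: "bounded_linear A"
proof -
  have "((\<lambda>x. r *\<^sub>R A x) ^^ n) x = r ^ n *\<^sub>R (A ^^ n) x" for n
    by (induction n) (auto simp: linear_simps[OF A])
  then show ?thesis
    by (simp add: exponential_def power_mult_distrib mult.commute)
qed

text \<open>
  A bounded operator that intertwines two generators intertwines the groups, term by term in the
  exponential series.
\<close>

lemma exponential_intertwine:
  assumes P: "bounded_linear P" and A: "bounded_linear A" and B: "bounded_linear B"
    and PB: "\<And>x. P (B x) = A (P x)"
  shows "P (exponential B t x) = exponential A t (P x)"
proof -
  have pow: "P ((B ^^ n) x) = (A ^^ n) (P x)" for n
    by (induction n) (auto simp: PB)
  have "(\<lambda>n. (t ^ n / fact n) *\<^sub>R (A ^^ n) (P x)) sums P (exponential B t x)"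
    using bounded_linear.sums[OF P exponential_sums[OF B, of t x]]
    by (simp add: linear_simps[OF P] pow)
  then show ?thesis
    using exponential_sums[OF A] by (rule sums_unique2)
qed

lemma has_vector_derivative_imp_quotient:
  assumes "(f has_vector_derivative D) (at 0)"
  shows "((\<lambda>t. (f t - f 0) /\<^sub>R t) \<longlongrightarrow> D) (at 0)"
proof -
  have "((\<lambda>t. norm (f t - f 0 - t *\<^sub>R D) / norm t) \<longlongrightarrow> 0) (at 0)"
    using assms by (simp add: has_vector_derivative_def has_derivative_at)
  moreover have "norm (f t - f 0 - t *\<^sub>R D) / norm t = norm ((f t - f 0) /\<^sub>R t - D)" if "t \<noteq> 0" for t
  proof -
    have "(f t - f 0) /\<^sub>R t - D = (f t - f 0 - t *\<^sub>R D) /\<^sub>R t"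
      using that by (simp add: algebra_simps)
    then show ?thesis by (simp add: divide_inverse_commute)
  qed
  ultimately have "((\<lambda>t. norm ((f t - f 0) /\<^sub>R t - D)) \<longlongrightarrow> 0) (at 0)"
    by (subst (asm) tendsto_cong[where g = "\<lambda>t. norm ((f t - f 0) /\<^sub>R t - D)"])
       (auto simp: eventually_at_filter)
  then show ?thesis
    by (simp add: LIM_zero_iff tendsto_norm_zero_iff)
qed

lemma exponential_is_generator:
  fixes B :: "'a::complex_hilbert_space \<Rightarrow> 'a"
  assumes "bounded_linear B"
  shows "is_generator (exponential B) B"
  unfolding is_generator_def
proof
  fix x
  let ?F = "Op 0 (Blinfun B)"
  have "((\<lambda>t. blin (exp (t *\<^sub>R ?F)) x) has_vector_derivative blin (?F * exp (0 *\<^sub>R ?F)) x) (at 0)"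
    by (rule bounded_linear.has_vector_derivative[OF bounded_linear_blin_apply
          exp_scaleR_has_vector_derivative_left])
  from has_vector_derivative_imp_quotient[OF this]
  show "((\<lambda>t. (exponential B t x - x) /\<^sub>R t) \<longlongrightarrow> B x) (at 0)"
    by (simp add: assms bounded_linear_Blinfun_apply
        exponential_eq_blin_exp[of ?F, simplified assms blin_Op_Blinfun[OF assms], symmetric])
qed

lemma exponential_uniformly_continuous_group:
  fixes B :: "'a::complex_hilbert_space \<Rightarrow> 'a"
  assumes "bounded_clinear B"
  shows "uniformly_continuous_group (exponential B)"
proof -
  let ?F = "Op 0 (Blinfun B)"
  have B: "bounded_linear B" using assms by (rule bounded_clinear_bounded_linear)
  have eq: "exponential B t = blin (exp (t *\<^sub>R ?F))" for t
    using exponential_eq_blin_exp[of ?F t] blin_Op_Blinfun[OF B, of 0] by auto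
  have "bounded_linear (exponential B t)" for t
    unfolding eq by (rule blinfun.bounded_linear_right)
  moreover have "exponential B t (c *\<^sub>C x) = c *\<^sub>C exponential B t x" for t c x
    by (rule exponential_intertwine[OF bounded_linear_scaleC_right B B, symmetric])
       (simp add: bounded_clinear_scaleC[OF assms])
  moreover have "exponential B 0 = id"
    by (auto simp: eq)
  moreover have "exponential B (t + s) = exponential B t \<circ> exponential B s" for t s
  proof -
    have "exp ((t + s) *\<^sub>R ?F) = exp (t *\<^sub>R ?F) * exp (s *\<^sub>R ?F)"
      unfolding scaleR_add_left by (rule exp_add_commuting) simp
    then show ?thesis by (auto simp: eq)
  qed
  moreover have "((\<lambda>t. onorm (\<lambda>x. exponential B t x - x)) \<longlongrightarrow> 0) (at 0)"
  proof -
    have "isCont (\<lambda>t. blin (exp (t *\<^sub>R ?F))) 0"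
      by (intro bounded_linear.continuous[OF bounded_linear_blin]
          has_vector_derivative_continuous[OF exp_scaleR_has_vector_derivative_left])
    then have "((\<lambda>t. norm (blin (exp (t *\<^sub>R ?F)) - id_blinfun)) \<longlongrightarrow> 0) (at 0)"
      by (simp add: isCont_def LIM_zero_iff tendsto_norm_zero_iff)
    then show ?thesis
      by (simp add: norm_blinfun.rep_eq minus_blinfun.rep_eq eq)
  qed
  ultimately show ?thesis
    by (simp add: uniformly_continuous_group_def bounded_clinear_def)
qed

text \<open>
  The group is norm-continuous in the Banach algebra of real-linear bounded operators, so it is an
  exponential there. Complex linearity passes from the operators to their derivative at \<open>0\<close>.
\<close>

lemma uniformly_continuous_group_is_exponential:
  fixes T :: "real \<Rightarrow> 'a::complex_hilbert_space \<Rightarrow> 'a"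
  assumes T: "uniformly_continuous_group T"
  obtains B where "bounded_clinear B" "T = exponential B"
proof -
  have Tc: "bounded_clinear (T t)" for t
    using T by (simp add: uniformly_continuous_group_def)
  then have Tl: "bounded_linear (T t)" for t
    by (rule bounded_clinear_bounded_linear)
  define G where "G t = Op 1 (Blinfun (T t))" for t
  have blin_G: "blinfun_apply (blin (G t)) = T t" for t
    unfolding G_def by (rule blin_Op_Blinfun[OF Tl])
  have G0: "G 0 = 1"
    using T blin_G[of 0] unfolding uniformly_continuous_group_def
    by (intro operator.expand) (auto simp: G_def one_operator_def intro!: blinfun_eqI)
  have add: "G (s + t) = G s * G t" for s t
    using T blin_G unfolding uniformly_continuous_group_def
    by (intro operator.expand conjI blinfun_eqI) (auto simp: times_operator_def, simp add: G_def)
  have "norm (G t - 1) = onorm (\<lambda>x. T t x - x)" for t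
  proof -
    have "norm (G t - 1) = norm (blin (G t) - id_blinfun)"
      by (simp add: norm_operator_def minus_operator_def one_operator_def) (simp add: G_def)
    then show ?thesis
      by (simp add: norm_blinfun.rep_eq minus_blinfun.rep_eq blin_G)
  qed
  then have "((\<lambda>t. norm (G t - 1)) \<longlongrightarrow> 0) (at 0)"
    using T by (simp add: uniformly_continuous_group_def)
  then have "(G \<longlongrightarrow> 1) (at 0)"
    by (simp add: LIM_zero_iff tendsto_norm_zero_iff)
  from norm_continuous_group_is_exp[OF G0 add this]
  obtain b where b: "\<And>t. G t = exp (t *\<^sub>R b)" by blast
  define B where "B = blinfun_apply (blin b)"
  have eq: "T = exponential B"
    by (intro ext) (metis B_def blin_G b exponential_eq_blin_exp)
  have Bl: "bounded_linear B"
    unfolding B_def by (rule blinfun.bounded_linear_right)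
  have gen: "((\<lambda>t. (T t x - x) /\<^sub>R t) \<longlongrightarrow> B x) (at 0)" for x
    using exponential_is_generator[OF Bl] unfolding eq is_generator_def by blast
  have "B (c *\<^sub>C x) = c *\<^sub>C B x" for c x
  proof (rule tendsto_unique[OF _ gen])
    have "((\<lambda>t. c *\<^sub>C ((T t x - x) /\<^sub>R t)) \<longlongrightarrow> c *\<^sub>C B x) (at 0)"
      by (rule bounded_linear.tendsto[OF bounded_linear_scaleC_right gen])
    then show "((\<lambda>t. (T t (c *\<^sub>C x) - c *\<^sub>C x) /\<^sub>R t) \<longlongrightarrow> c *\<^sub>C B x) (at 0)"
      by (simp add: linear_simps[OF bounded_linear_scaleC_right] bounded_clinear_scaleC[OF Tc])
  qed simp
  with Bl have "bounded_clinear B" by (simp add: bounded_clinear_def)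
  then show thesis using eq by (rule that)
qed

lemma is_generator_unique: "is_generator T A \<Longrightarrow> is_generator T B \<Longrightarrow> A = B"
  unfolding is_generator_def by (intro ext) (meson tendsto_unique at_neq_bot)

section \<open>Restrictions to invariant subspaces as embeddings\<close>

text \<open>
  An isomorphism \<open>R\<close> from a subspace onto the space and the embedding \<open>P\<close> inverse to it determine
  each other. Embeddings are total maps and can be composed, which spares the bookkeeping of
  domains.
\<close>

definition embedding :: "('a::complex_inner \<Rightarrow> 'a) \<Rightarrow> bool" where
  "embedding P \<longleftrightarrow> bounded_clinear P \<and> (\<exists>m. \<forall>x. norm x \<le> m * norm (P x))"

lemma embedding_compose:
  assumes "embedding P" "embedding Q"
  shows "embedding (\<lambda>x. P (Q x))"
proof -
  obtain m n where m: "\<And>x. norm x \<le> m * norm (P x)" and n: "\<And>x. norm x \<le> n * norm (Q x)"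
    using assms unfolding embedding_def by blast
  have "norm x \<le> \<bar>n\<bar> * \<bar>m\<bar> * norm (P (Q x))" for x
  proof -
    have "norm x \<le> \<bar>n\<bar> * norm (Q x)"
      by (rule order_trans[OF n]) (simp add: mult_right_mono)
    also have "\<dots> \<le> \<bar>n\<bar> * (\<bar>m\<bar> * norm (P (Q x)))"
      by (intro mult_left_mono order_trans[OF m]) (auto simp: mult_right_mono)
    finally show ?thesis by (simp add: mult.assoc)
  qed
  then show ?thesis
    using assms unfolding embedding_def by (auto intro: bounded_clinear_compose)
qed

lemma embedding_inv_into:
  assumes M: "csubspace M" and R: "bounded_clinear_iso_on M R"
  shows "embedding (inv_into M R)"
proof -
  have bij: "bij_betw R M UNIV" using R by (simp add: bounded_clinear_iso_on_def)
  obtain K L where K: "\<And>x. x \<in> M \<Longrightarrow> norm (R x) \<le> K * norm x"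
    and L: "\<And>y. norm (inv_into M R y) \<le> L * norm y"
    using R unfolding bounded_clinear_iso_on_def by blast
  have mem: "inv_into M R y \<in> M" for y
    using bij by (metis UNIV_I bij_betw_def inv_into_into)
  have R_inv: "R (inv_into M R y) = y" for y
    using bij by (simp add: bij_betw_inv_into_right)
  have inv_R: "inv_into M R (R x) = x" if "x \<in> M" for x
    using bij that by (simp add: bij_betw_inv_into_left)
  have "bounded_clinear (inv_into M R)"
  proof (rule bounded_clinearI[OF _ _ L])
    fix x y and c :: complex
    have "inv_into M R x + inv_into M R y \<in> M" "c *\<^sub>C inv_into M R x \<in> M"
      using M mem by (auto intro: complex_vector.subspace_add complex_vector.subspace_scale)
    moreover have "R (inv_into M R x + inv_into M R y) = x + y" "R (c *\<^sub>C inv_into M R x) = c *\<^sub>C x"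
      using R mem by (auto simp: bounded_clinear_iso_on_def R_inv)
    ultimately show "inv_into M R (x + y) = inv_into M R x + inv_into M R y"
      "inv_into M R (c *\<^sub>C x) = c *\<^sub>C inv_into M R x"
      using inv_R by metis+
  qed
  moreover have "norm x \<le> K * norm (inv_into M R x)" for x
    using K[OF mem, of x] by (simp add: R_inv)
  ultimately show ?thesis unfolding embedding_def by blast
qed

text \<open>
  The converse of \<open>embedding_inv_into\<close>. The range is complete, hence closed, because \<open>P\<close> is bounded
  below.
\<close>

lemma embedding_range:
  fixes P :: "'a::complex_hilbert_space \<Rightarrow> 'a"
  assumes P: "embedding P"
  shows csubspace_range_embedding: "csubspace (range P)"
    and closed_range_embedding: "closed (range P)"
    and inj_embedding: "inj P"
    and iso_on_range_embedding: "bounded_clinear_iso_on (range P) (inv P)"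
    and inv_into_range_embedding: "inv_into (range P) (inv P) = P"
proof -
  have lin: "bounded_clinear P" using P by (simp add: embedding_def)
  obtain m where m: "\<And>x. norm x \<le> m * norm (P x)"
    using P unfolding embedding_def by blast
  show "csubspace (range P)"
  proof (rule complex_vector.subspaceI)
    show "0 \<in> range P"
      by (rule range_eqI[of _ _ 0]) (simp add: bounded_clinear_zero[OF lin])
    show "x + y \<in> range P" if "x \<in> range P" "y \<in> range P" for x y
      using that by (auto simp flip: bounded_clinear_add[OF lin])
    show "c *\<^sub>C x \<in> range P" if "x \<in> range P" for c x
      using that by (auto simp flip: bounded_clinear_scaleC[OF lin])
  qed
  have m': "norm x \<le> (\<bar>m\<bar> + 1) * norm (P x)" for x
    by (rule order_trans[OF m]) (auto intro: mult_right_mono)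
  have "1 / (\<bar>m\<bar> + 1) * norm x \<le> norm (P x)" for x
    using m'[of x] by (simp add: field_simps)
  then have "complete (range P)"
    using complete_isometric_image[of "1 / (\<bar>m\<bar> + 1)" UNIV P]
    by (simp add: bounded_clinear_bounded_linear[OF lin] complete_UNIV)
  then show "closed (range P)" by (rule complete_imp_closed)
  show inj: "inj P"
  proof (rule injI)
    fix x y assume "P x = P y"
    then have "P (x - y) = 0"
      by (simp add: linear_simps[OF bounded_clinear_bounded_linear[OF lin]])
    then show "x = y" using m[of "x - y"] by simp
  qed
  have bij: "bij_betw (inv P) (range P) UNIV"
    using inj by (simp add: inj_imp_bij_betw_inv)
  show inv: "inv_into (range P) (inv P) = P"
  proof
    show "inv_into (range P) (inv P) x = P x" for x
      using bij_betw_inv_into_left[OF bij, of "P x"] inj by simp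
  qed
  show "bounded_clinear_iso_on (range P) (inv P)"
    unfolding bounded_clinear_iso_on_def inv
  proof (intro conjI ballI allI bij)
    show "inv P (x + y) = inv P x + inv P y" if "x \<in> range P" "y \<in> range P" for x y
      using that inj by (auto simp flip: bounded_clinear_add[OF lin])
    show "inv P (c *\<^sub>C x) = c *\<^sub>C inv P x" if "x \<in> range P" for c x
      using that inj by (auto simp flip: bounded_clinear_scaleC[OF lin])
    show "\<exists>K. \<forall>x\<in>range P. norm (inv P x) \<le> K * norm x"
      using m inj by (intro exI[of _ m]) auto
    show "\<exists>K. \<forall>x. norm (P x) \<le> K * norm x"
      using bounded_linear.bounded[OF bounded_clinear_bounded_linear[OF lin]]
      by (simp add: mult.commute)
  qed
qed

lemma universal_embedding:
  fixes A :: "'a::complex_hilbert_space \<Rightarrow> 'a"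
  assumes "universal A" "bounded_clinear T"
  obtains Q c where "embedding Q" "\<And>x. Q (T x) = c *\<^sub>C A (Q x)"
proof -
  obtain M c R where M: "csubspace M" "A ` M \<subseteq> M" and R: "bounded_clinear_iso_on M R"
    and T: "\<And>x. T x = c *\<^sub>C R (A (inv_into M R x))"
    using assms unfolding universal_def by metis
  define Q where "Q = inv_into M R"
  have bij: "bij_betw R M UNIV" using R by (simp add: bounded_clinear_iso_on_def)
  have Q: "embedding Q" unfolding Q_def by (rule embedding_inv_into[OF M(1) R])
  have rQ: "range Q = M"
    unfolding Q_def using bij_betw_inv_into[OF bij] by (simp add: bij_betw_def)
  have "Q (T x) = c *\<^sub>C A (Q x)" for x
  proof -
    have "A (Q x) \<in> M" using M(2) rQ by blast
    then have "Q (R (A (Q x))) = A (Q x)"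
      unfolding Q_def by (rule bij_betw_inv_into_left[OF bij])
    then show ?thesis
      using Q by (simp add: embedding_def T bounded_clinear_scaleC flip: Q_def)
  qed
  then show thesis by (rule that[OF Q])
qed

section \<open>Groups and universality\<close>

text \<open>
  Universality for \<open>backward_shift B\<close> provides \<open>Q\<close> and \<open>c\<close>; composing \<open>Q\<close> with
  \<open>eigen_embedding z\<close> turns the factor \<open>c\<close> into \<open>c / z\<close>, and \<open>z\<close> may have any argument.
\<close>

lemma universal_positive_multiple:
  fixes A B :: "'a::complex_hilbert_space \<Rightarrow> 'a"
  assumes sep: "separable_space (euclidean :: 'a topology)"
    and inf: "infinite_dimensional TYPE('a)"
    and A: "universal A" and B: "bounded_clinear B" and nz: "B x0 \<noteq> 0"
  obtains P \<mu> where "embedding P" "0 < \<mu>" "\<And>x. P (B x) = \<mu> *\<^sub>R A (P x)"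
proof -
  obtain e :: "nat \<Rightarrow> 'a" where "orthonormal_basis e"
    using orthonormal_basis_exists[OF sep inf] .
  then interpret orthonormal_basis e .
  obtain Q c where Q: "embedding Q" and int: "\<And>x. Q (backward_shift B x) = c *\<^sub>C A (Q x)"
    using universal_embedding[OF A bounded_clinear_backward_shift[OF B]] by metis
  have Qc: "bounded_clinear Q" using Q by (simp add: embedding_def)
  have emb: "embedding (\<lambda>x. Q (eigen_embedding z x))" if z: "cmod z < 1" for z
  proof (rule embedding_compose[OF Q])
    have "norm x \<le> 1 * norm (eigen_embedding z x)" for x
      using copy_out_eigen_embedding[OF z, of 0 x]
        norm_relabel_le[OF inj_prod_encode_row inj_on_id, of 0 "eigen_embedding z x"]
      by (simp add: copy_out_def)
    then show "embedding (eigen_embedding z)"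
      unfolding embedding_def using bounded_clinear_eigen_embedding[OF z] by blast
  qed
  have eq: "z *\<^sub>C Q (eigen_embedding z (B x)) = c *\<^sub>C A (Q (eigen_embedding z x))"
    if z: "cmod z < 1" for z x
    by (simp add: bounded_clinear_scaleC[OF Qc] backward_shift_eigen_embedding[OF B z] flip: int)
  have "c \<noteq> 0"
  proof
    assume "c = 0"
    let ?P = "\<lambda>x. Q (eigen_embedding (1/2) x)"
    have P: "embedding ?P" by (rule emb) (simp add: norm_divide)
    have "(1/2) *\<^sub>C ?P (B x0) = 0"
      using eq[of "1/2" x0] \<open>c = 0\<close> by (simp add: norm_divide)
    then have "?P (B x0) = 0"
      by (simp add: complex_vector.scale_eq_0_iff)
    also have "\<dots> = ?P 0"
      using P bounded_clinear_zero[of ?P] by (simp add: embedding_def)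
    finally have "B x0 = 0"
      by (rule injD[OF inj_embedding[OF P]])
    with nz show False ..
  qed
  \<comment> \<open>\<open>z\<close> has the argument of \<open>c\<close> and modulus \<open>1/2\<close>, so that \<open>c / z = 2 \<bar>c\<bar>\<close> is positive.\<close>
  define z where "z = c / of_real (2 * cmod c)"
  have z: "cmod z < 1" using \<open>c \<noteq> 0\<close> by (simp add: z_def norm_divide)
  have "Q (eigen_embedding z (B x)) = (2 * cmod c) *\<^sub>R A (Q (eigen_embedding z x))" for x
  proof -
    have "Q (eigen_embedding z (B x)) = inverse z *\<^sub>C z *\<^sub>C Q (eigen_embedding z (B x))"
      using \<open>c \<noteq> 0\<close> by (simp add: scaleC_scaleC z_def)
    also have "\<dots> = (inverse z * c) *\<^sub>C A (Q (eigen_embedding z x))"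
      unfolding eq[OF z] scaleC_scaleC ..
    also have "inverse z * c = of_real (2 * cmod c)"
      using \<open>c \<noteq> 0\<close> by (simp add: z_def)
    finally show ?thesis by (simp add: scaleC_of_real del: of_real_mult)
  qed
  then show thesis using that[OF emb[OF z], of "2 * cmod c"] \<open>c \<noteq> 0\<close> by simp
qed

text \<open>Both sides of the intertwining relation are differentiated at \<open>t = 0\<close>.\<close>

lemma generator_similar:
  fixes A :: "'a::complex_hilbert_space \<Rightarrow> 'a"
  assumes A: "bounded_linear A" and B: "bounded_linear B" and P: "embedding P"
    and int: "\<And>t x. P (exponential B t x) = exponential A (\<mu> * t) (P x)"
  shows "P (B x) = \<mu> *\<^sub>R A (P x)"
proof -
  have Pl: "bounded_linear P" using P by (simp add: embedding_def bounded_clinear_bounded_linear)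
  let ?q = "\<lambda>t. (exponential (\<lambda>x. \<mu> *\<^sub>R A x) t (P x) - P x) /\<^sub>R t"
  have "((\<lambda>t. P ((exponential B t x - x) /\<^sub>R t)) \<longlongrightarrow> P (B x)) (at 0)"
    using exponential_is_generator[OF B] unfolding is_generator_def
    by (intro bounded_linear.tendsto[OF Pl]) blast
  moreover have "P ((exponential B t x - x) /\<^sub>R t) = ?q t" for t
    by (simp add: linear_simps[OF Pl] int exponential_rescale[OF A])
  ultimately have "(?q \<longlongrightarrow> P (B x)) (at 0)" by simp
  moreover have "is_generator (exponential (\<lambda>x. \<mu> *\<^sub>R A x)) (\<lambda>x. \<mu> *\<^sub>R A x)"
    by (intro exponential_is_generator bounded_linear_compose[OF bounded_linear_scaleR_right A])
  then have "(?q \<longlongrightarrow> \<mu> *\<^sub>R A (P x)) (at 0)"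
    unfolding is_generator_def by blast
  ultimately show ?thesis by (rule tendsto_unique[OF at_neq_bot])
qed

lemma generator_invariant:
  fixes M :: "'a::complex_hilbert_space set"
  assumes "is_generator U A" "csubspace M" "closed M" "\<And>t. U t ` M \<subseteq> M" "x \<in> M"
  shows "A x \<in> M"
proof (rule Lim_in_closed_set[OF \<open>closed M\<close>])
  show "((\<lambda>t. (U t x - x) /\<^sub>R t) \<longlongrightarrow> A x) (at 0)"
    using assms(1) by (simp add: is_generator_def)
  show "\<forall>\<^sub>F t in at 0. (U t x - x) /\<^sub>R t \<in> M"
    using assms(4,5) unfolding scaleR_eq_scaleC
    by (intro always_eventually allI complex_vector.subspace_scale[OF assms(2)]
        complex_vector.subspace_diff[OF assms(2)]) auto
qed simp

theorem theorem3p2: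
  fixes U :: "real \<Rightarrow> 'a::complex_hilbert_space \<Rightarrow> 'a" and A :: "'a \<Rightarrow> 'a"
  assumes "separable_space (euclidean :: 'a topology)"
    and "infinite_dimensional TYPE('a)"
    and "uniformly_continuous_group U"
    and "is_generator U A"
  shows "(\<forall>T :: real \<Rightarrow> 'a \<Rightarrow> 'a. uniformly_continuous_group T \<longrightarrow>
            (\<exists>(M :: 'a set) (\<mu> :: real) (R :: 'a \<Rightarrow> 'a).
               csubspace M \<and> closed M \<and> (\<forall>t. U t ` M \<subseteq> M) \<and> 0 \<le> \<mu> \<and>
               bounded_clinear_iso_on M R \<and>
               (\<forall>t x. T t x = R (U (\<mu> * t) (inv_into M R x)))))
         \<longleftrightarrow> universal A" (is "?groups \<longleftrightarrow> _")
proof -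
  obtain A' where A': "bounded_clinear A'" "U = exponential A'"
    using uniformly_continuous_group_is_exponential[OF assms(3)] .
  have "A = A'"
    using is_generator_unique[OF assms(4)] A' exponential_is_generator bounded_clinear_bounded_linear
    by blast
  with A' have A: "bounded_clinear A" and U: "U = exponential A" by auto
  have Al: "bounded_linear A" using A by (rule bounded_clinear_bounded_linear)
  show ?thesis
  proof
    assume groups: ?groups
    show "universal A"
      unfolding universal_def
    proof (intro conjI A allI impI)
      fix T :: "'a \<Rightarrow> 'a" assume T: "bounded_clinear T"
      obtain M \<mu> R where M: "csubspace M" "closed M" "\<And>t. U t ` M \<subseteq> M"
        and R: "bounded_clinear_iso_on M R"
        and eq: "\<And>t x. exponential T t x = R (U (\<mu> * t) (inv_into M R x))"
        using groups[rule_format, OF exponential_uniformly_continuous_group[OF T]] by blast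
      have bij: "bij_betw R M UNIV" using R by (simp add: bounded_clinear_iso_on_def)
      have mem: "inv_into M R x \<in> M" for x
        using bij by (metis UNIV_I bij_betw_def inv_into_into)
      have AM: "A ` M \<subseteq> M"
        using generator_invariant[OF assms(4) M] by blast
      have "inv_into M R (exponential T t x) = U (\<mu> * t) (inv_into M R x)" for t x
        unfolding eq using M(3) mem by (intro bij_betw_inv_into_left[OF bij]) blast
      then have "inv_into M R (T x) = \<mu> *\<^sub>R A (inv_into M R x)" for x
        unfolding U
        by (intro generator_similar Al bounded_clinear_bounded_linear T embedding_inv_into[OF M(1) R])
      then have "T x = R (complex_of_real \<mu> *\<^sub>C A (inv_into M R x))" for x
        using bij_betw_inv_into_right[OF bij, of "T x"] by (simp add: scaleC_of_real)
      moreover have "R (complex_of_real \<mu> *\<^sub>C A (inv_into M R x)) =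
          complex_of_real \<mu> *\<^sub>C R (A (inv_into M R x))" for x
        using R AM mem unfolding bounded_clinear_iso_on_def by blast
      ultimately have "\<forall>x. T x = complex_of_real \<mu> *\<^sub>C R (A (inv_into M R x))"
        by simp
      then show "\<exists>M c R. csubspace M \<and> closed M \<and> A ` M \<subseteq> M \<and> bounded_clinear_iso_on M R \<and>
           (\<forall>x. T x = c *\<^sub>C R (A (inv_into M R x)))"
        using M(1,2) AM R by blast
    qed
  next
    assume univ: "universal A"
    have *: "\<exists>P \<mu>. embedding P \<and> 0 \<le> \<mu> \<and> (\<forall>t. U t ` range P \<subseteq> range P) \<and>
        (\<forall>t x. P (exponential B t x) = U (\<mu> * t) (P x))" if B: "bounded_clinear B" for B
    proof (cases "\<exists>x. B x \<noteq> 0")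
      case True
      then obtain P \<mu> where P: "embedding P" and "0 < \<mu>" and PB: "\<And>x. P (B x) = \<mu> *\<^sub>R A (P x)"
        using universal_positive_multiple[OF assms(1,2) univ B] by metis
      have Pl: "bounded_linear P"
        using P by (simp add: embedding_def bounded_clinear_bounded_linear)
      have int: "P (exponential B t x) = U (\<mu> * t) (P x)" for t x
        unfolding U exponential_rescale[OF Al, symmetric]
        by (rule exponential_intertwine[of P "\<lambda>x. \<mu> *\<^sub>R A x"])
           (auto intro: bounded_linear_compose[OF bounded_linear_scaleR_right Al]
              bounded_clinear_bounded_linear B Pl PB)
      have "U t (P x) = P (exponential B (t / \<mu>) x)" for t x
        using int[of "t / \<mu>" x] \<open>0 < \<mu>\<close> by simp
      then have "\<forall>t. U t ` range P \<subseteq> range P" by auto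
      with P int \<open>0 < \<mu>\<close> show ?thesis by (intro exI[of _ P] exI[of _ \<mu>]) auto
    next
      case False
      \<comment> \<open>Here the group of \<open>B\<close> is constant, because \<open>B\<close> is its own multiple by \<open>0\<close>.\<close>
      then have "B = (\<lambda>x. 0 *\<^sub>R B x)" by auto
      then have "exponential B t x = exponential B 0 x" for t x
        using exponential_rescale[of B 0 t x] bounded_clinear_bounded_linear[OF B] by simp
      moreover have "exponential B 0 x = x" "U 0 x = x" for x
        using exponential_uniformly_continuous_group[OF B] assms(3)
        by (auto simp: uniformly_continuous_group_def)
      moreover have "embedding (\<lambda>x. x :: 'a)"
        unfolding embedding_def using bounded_clinear_id by (auto intro: exI[of _ 1])
      ultimately show ?thesis
        by (intro exI[of _ "\<lambda>x. x"] exI[of _ 0]) auto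
    qed
    show ?groups
    proof (intro allI impI)
      fix T :: "real \<Rightarrow> 'a \<Rightarrow> 'a" assume "uniformly_continuous_group T"
      then obtain B where B: "bounded_clinear B" "T = exponential B"
        by (rule uniformly_continuous_group_is_exponential)
      obtain P \<mu> where P: "embedding P" "0 \<le> \<mu>" "\<forall>t. U t ` range P \<subseteq> range P"
        and int: "\<And>t x. P (T t x) = U (\<mu> * t) (P x)"
        using *[OF B(1)] B(2) by blast
      have "T t x = inv P (U (\<mu> * t) (inv_into (range P) (inv P) x))" for t x
        unfolding inv_into_range_embedding[OF P(1)] int[symmetric]
        using inj_embedding[OF P(1)] by simp
      then show "\<exists>M \<mu> R. csubspace M \<and> closed M \<and> (\<forall>t. U t ` M \<subseteq> M) \<and> 0 \<le> \<mu> \<and>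
          bounded_clinear_iso_on M R \<and> (\<forall>t x. T t x = R (U (\<mu> * t) (inv_into M R x)))"
        using P csubspace_range_embedding closed_range_embedding iso_on_range_embedding by blast
    qed
  qed
qed

end
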